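(* Let $\Lambda$ be an ordered abelian group such that $\Lambda\neq 2\Lambda$, or let $\Lambda$ be the additive group of an ordered field. Then axiom (2) is independent of the axioms (1) and (3); that is, there exists a $\Lambda$-metric space that satisfies axioms (1) and (3) but does not satisfy axiom (2).
   Context: An ordered abelian group $(\Lambda,+)$ is an abelian group with a translation-invariant total order; $2\Lambda=\{2\lambda : \lambda\in\Lambda\}$. A $\Lambda$-metric space is a set $X$ with a function $d\colon X\times X\to\Lambda$ that is positive definite ($d(x,y)\ge 0$, with equality iff $x=y$), symmetric and satisfies the triangle inequality. A closed $\Lambda$-interval is a set $[a,b]=\{\lambda\in\Lambda : a\le\lambda\le b\}$ with $a\le b$ in $\Lambda$, equipped with the $\Lambda$-metric $d_\Lambda(t,t')=|t'-t|$. A segment in $X$ is the image $s=\varphi([a,b])\subseteq X$ of an isometric embedding (distance-preserving map) $\varphi\colon[a,b]\to X$ of a closed $\Lambda$-interval; the endpoints of $s$ are $\varphi(a)$ and $\varphi(b)$ (the set of endpoints does not depend on $\varphi$). $X$ is geodesic if for any $p,q\in X$ there exists a segment with endpoints $p$ and $q$. The axioms for a $\Lambda$-metric space $(X,d)$ are: (1) $(X,d)$ is geodesic. (2) If two segments $s,s'\subseteq X$ intersect in a single point $s\cap s'=\{p\}$, which is an endpoint of $s$ and of $s'$, then their union $s\cup s'$ is a segment. (3) If two segments $s,s'\subseteq X$ have an endpoint in common, then their intersection $s\cap s'$ is a segment. *)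

theory Defs
  imports Main
begin

text \<open>
  The ordered abelian group \<open>\<Lambda>\<close> is a type \<open>'l\<close> of class \<^class>\<open>linordered_ab_group_add\<close>. This
  class has no absolute value, so \<open>\<bar>t' - t\<bar>\<close> is written out.
\<close>

definition dist_Lambda :: "'l::linordered_ab_group_add \<Rightarrow> 'l \<Rightarrow> 'l" where
  "dist_Lambda t t' = (if t \<le> t' then t' - t else t - t')"

definition double_Lambda :: "'l::linordered_ab_group_add set" where
  "double_Lambda = {l + l | l. True}"

definition Lambda_metric_space ::
    "'x set \<Rightarrow> ('x \<Rightarrow> 'x \<Rightarrow> 'l::linordered_ab_group_add) \<Rightarrow> bool" where
  "Lambda_metric_space X d \<longleftrightarrow>
     (\<forall>x\<in>X. \<forall>y\<in>X. 0 \<le> d x y \<and> (d x y = 0 \<longleftrightarrow> x = y)) \<and>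
     (\<forall>x\<in>X. \<forall>y\<in>X. d x y = d y x) \<and>
     (\<forall>x\<in>X. \<forall>y\<in>X. \<forall>z\<in>X. d x z \<le> d x y + d y z)"

definition isometric_embedding ::
    "'x set \<Rightarrow> ('x \<Rightarrow> 'x \<Rightarrow> 'l) \<Rightarrow> 'l::linordered_ab_group_add \<Rightarrow> 'l \<Rightarrow> ('l \<Rightarrow> 'x) \<Rightarrow> bool" where
  "isometric_embedding X d a b \<phi> \<longleftrightarrow>
     \<phi> ` {a..b} \<subseteq> X \<and>
     (\<forall>t\<in>{a..b}. \<forall>t'\<in>{a..b}. d (\<phi> t) (\<phi> t') = dist_Lambda t t')"

text \<open>\<open>E\<close> is the set of the (one or two) endpoints of the segment \<open>s\<close>.\<close>

definition segment_with_endpoints ::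
    "'x set \<Rightarrow> ('x \<Rightarrow> 'x \<Rightarrow> 'l::linordered_ab_group_add) \<Rightarrow> 'x set \<Rightarrow> 'x set \<Rightarrow> bool" where
  "segment_with_endpoints X d s E \<longleftrightarrow>
     (\<exists>a b \<phi>. a \<le> b \<and> isometric_embedding X d a b \<phi> \<and> s = \<phi> ` {a..b} \<and> E = {\<phi> a, \<phi> b})"

definition segment ::
    "'x set \<Rightarrow> ('x \<Rightarrow> 'x \<Rightarrow> 'l::linordered_ab_group_add) \<Rightarrow> 'x set \<Rightarrow> bool" where
  "segment X d s \<longleftrightarrow> (\<exists>E. segment_with_endpoints X d s E)"

definition endpoint ::
    "'x set \<Rightarrow> ('x \<Rightarrow> 'x \<Rightarrow> 'l::linordered_ab_group_add) \<Rightarrow> 'x set \<Rightarrow> 'x \<Rightarrow> bool" where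
  "endpoint X d s p \<longleftrightarrow> (\<exists>E. segment_with_endpoints X d s E \<and> p \<in> E)"

definition axiom1 :: "'x set \<Rightarrow> ('x \<Rightarrow> 'x \<Rightarrow> 'l::linordered_ab_group_add) \<Rightarrow> bool" where
  "axiom1 X d \<longleftrightarrow> (\<forall>p\<in>X. \<forall>q\<in>X. \<exists>s. segment_with_endpoints X d s {p, q})"

definition axiom2 :: "'x set \<Rightarrow> ('x \<Rightarrow> 'x \<Rightarrow> 'l::linordered_ab_group_add) \<Rightarrow> bool" where
  "axiom2 X d \<longleftrightarrow>
     (\<forall>s s' p. segment X d s \<and> segment X d s' \<and> s \<inter> s' = {p} \<and>
        endpoint X d s p \<and> endpoint X d s' p \<longrightarrow> segment X d (s \<union> s'))"

definition axiom3 :: "'x set \<Rightarrow> ('x \<Rightarrow> 'x \<Rightarrow> 'l::linordered_ab_group_add) \<Rightarrow> bool" where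
  "axiom3 X d \<longleftrightarrow>
     (\<forall>s s' p. segment X d s \<and> segment X d s' \<and>
        endpoint X d s p \<and> endpoint X d s' p \<longrightarrow> segment X d (s \<inter> s'))"

end

theory Submission
  imports Defs
begin

text \<open>
  Call a metric space nonbranching if two points at the same distance from \<open>p\<close>, both collinear with
  \<open>p\<close> and \<open>y \<noteq> p\<close> but without \<open>p\<close> in the middle, are equal. In such a space two segments with a
  common endpoint \<open>p\<close> meet only in \<open>p\<close> or are nested, which gives axiom (3). If moreover the space
  is geodesic and contains three points none of which is between the two others, then the segments
  from one of them to the two others violate axiom (2).

  If \<open>\<Lambda> \<noteq> 2\<Lambda>\<close>, a circle whose circumference is not in \<open>2\<Lambda>\<close> is such a space. Over an ordered
  field, so is the plane with a strictly convex norm; a Euclidean norm would need square roots, but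
  \<open>\<bar>x\<bar> + \<bar>y\<bar> - \<bar>x y\<bar> / (\<bar>x\<bar> + \<bar>y\<bar>)\<close> is strictly convex and uses field operations only.
\<close>

section \<open>Nonbranching spaces\<close>

definition between :: "('x \<Rightarrow> 'x \<Rightarrow> 'l::plus) \<Rightarrow> 'x \<Rightarrow> 'x \<Rightarrow> 'x \<Rightarrow> bool" where
  "between d x y z \<longleftrightarrow> d x z = d x y + d y z"

definition nonbranching :: "'x set \<Rightarrow> ('x \<Rightarrow> 'x \<Rightarrow> 'l::plus) \<Rightarrow> bool" where
  "nonbranching X d \<longleftrightarrow> (\<forall>p\<in>X. \<forall>y\<in>X. \<forall>z\<in>X. \<forall>z'\<in>X.
     y \<noteq> p \<longrightarrow> d p z = d p z' \<longrightarrow>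
     between d p z y \<or> between d p y z \<longrightarrow>
     between d p z' y \<or> between d p y z' \<longrightarrow> z = z')"

text \<open>Shifting the parameter interval, and reversing it when \<open>p\<close> is its far end,
  puts \<open>p\<close> at parameter 0. Parameters then are distances from \<open>p\<close>, so two
  segments from \<open>p\<close> can be compared.\<close>

lemma isometric_embedding_from_endpoint:
  fixes d :: "'x \<Rightarrow> 'x \<Rightarrow> 'l::linordered_ab_group_add"
  assumes "endpoint X d s p"
  obtains l \<phi> where "0 \<le> l" "isometric_embedding X d 0 l \<phi>" "s = \<phi> ` {0..l}" "\<phi> 0 = p"
proof -
  obtain a b \<phi> where ab: "a \<le> b" and iso: "isometric_embedding X d a b \<phi>"
    and s: "s = \<phi> ` {a..b}" and p: "p = \<phi> a \<or> p = \<phi> b"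
    using assms unfolding endpoint_def segment_with_endpoints_def by blast
  have im: "(\<lambda>t. a + t) ` {0..b - a} = {a..b}"
  proof (intro equalityI subsetI)
    show "x \<in> (\<lambda>t. a + t) ` {0..b - a}" if "x \<in> {a..b}" for x
      using that by (intro image_eqI[of _ _ "x - a"]) auto
  qed (auto simp: algebra_simps)
  have im': "(\<lambda>t. b - t) ` {0..b - a} = {a..b}"
  proof (intro equalityI subsetI)
    show "x \<in> (\<lambda>t. b - t) ` {0..b - a}" if "x \<in> {a..b}" for x
      using that by (intro image_eqI[of _ _ "b - x"]) auto
  qed (auto simp: algebra_simps)
  from p show thesis
  proof
    assume "p = \<phi> a"
    moreover have "s = (\<lambda>t. \<phi> (a + t)) ` {0..b - a}"
      unfolding s by (subst im[symmetric]) (rule image_image)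
    moreover from this have "isometric_embedding X d 0 (b - a) (\<lambda>t. \<phi> (a + t))"
      using iso s unfolding isometric_embedding_def dist_Lambda_def
      by (auto simp: algebra_simps)
    ultimately show thesis
      using ab by (intro that[of "b - a" "\<lambda>t. \<phi> (a + t)"]) simp_all
  next
    assume "p = \<phi> b"
    moreover have "s = (\<lambda>t. \<phi> (b - t)) ` {0..b - a}"
      unfolding s by (subst im'[symmetric]) (rule image_image)
    moreover from this have "isometric_embedding X d 0 (b - a) (\<lambda>t. \<phi> (b - t))"
      using iso s unfolding isometric_embedding_def dist_Lambda_def
      by (auto simp: algebra_simps)
    ultimately show thesis
      using ab by (intro that[of "b - a" "\<lambda>t. \<phi> (b - t)"]) simp_all
  qed
qed

text \<open>Betweenness holds among the parameters because they are linearly ordered, and an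
  isometry carries it over. It serves as an obstruction to lying in one segment.\<close>

lemma segment_three_points:
  fixes d :: "'x \<Rightarrow> 'x \<Rightarrow> 'l::linordered_ab_group_add"
  assumes "segment X d s" "x \<in> s" "y \<in> s" "z \<in> s"
  shows "between d x y z \<or> between d x z y \<or> between d y x z"
proof -
  have ordered: "between dist_Lambda t u v \<and> between dist_Lambda v u t" if "t \<le> u" "u \<le> v" for t u v :: 'l
    using that by (auto simp: between_def dist_Lambda_def)
  obtain a b \<phi> where iso: "isometric_embedding X d a b \<phi>" and s: "s = \<phi> ` {a..b}"
    using assms(1) unfolding segment_def segment_with_endpoints_def by blast
  obtain t u v where "t \<in> {a..b}" "u \<in> {a..b}" "v \<in> {a..b}" "x = \<phi> t" "y = \<phi> u" "z = \<phi> v"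
    using assms(2-4) s by blast
  moreover have "between dist_Lambda t u v \<or> between dist_Lambda t v u \<or> between dist_Lambda u t v"
    using ordered linear by metis
  ultimately show ?thesis
    using iso unfolding isometric_embedding_def between_def by metis
qed

text \<open>With both segments parametrized by the distance from \<open>p\<close>, a second common
  point \<open>y\<close> has the same parameter on both. Nonbranching, applied with this
  \<open>y\<close>, makes the parametrizations agree wherever both are defined, so the shorter
  segment lies in the longer.\<close>

lemma segment_Int_cases:
  fixes d :: "'x \<Rightarrow> 'x \<Rightarrow> 'l::linordered_ab_group_add"
  assumes nb: "nonbranching X d"
    and "endpoint X d s p" "endpoint X d s' p"
  shows "s \<inter> s' = {p} \<or> s \<subseteq> s' \<or> s' \<subseteq> s"
proof -
  obtain l \<phi> where l: "0 \<le> l" and \<phi>: "isometric_embedding X d 0 l \<phi>"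
    and s: "s = \<phi> ` {0..l}" and \<phi>0: "\<phi> 0 = p"
    using assms(2) by (rule isometric_embedding_from_endpoint)
  obtain m \<psi> where m: "0 \<le> m" and \<psi>: "isometric_embedding X d 0 m \<psi>"
    and s': "s' = \<psi> ` {0..m}" and \<psi>0: "\<psi> 0 = p"
    using assms(3) by (rule isometric_embedding_from_endpoint)
  have X: "\<phi> t \<in> X" if "t \<in> {0..l}" for t
    using that \<phi> unfolding isometric_embedding_def by blast
  have X': "\<psi> t \<in> X" if "t \<in> {0..m}" for t
    using that \<psi> unfolding isometric_embedding_def by blast
  have D: "d (\<phi> t) (\<phi> u) = dist_Lambda t u" if "t \<in> {0..l}" "u \<in> {0..l}" for t u
    using that \<phi> unfolding isometric_embedding_def by blast
  have D': "d (\<psi> t) (\<psi> u) = dist_Lambda t u" if "t \<in> {0..m}" "u \<in> {0..m}" for t u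
    using that \<psi> unfolding isometric_embedding_def by blast
  have dp: "d p (\<phi> t) = t" if "t \<in> {0..l}" for t
    using D[of 0 t] that l \<phi>0 by (simp add: dist_Lambda_def)
  have dp': "d p (\<psi> t) = t" if "t \<in> {0..m}" for t
    using D'[of 0 t] that m \<psi>0 by (simp add: dist_Lambda_def)
  show ?thesis
  proof (cases "s \<inter> s' = {p}")
    case False
    moreover have "p \<in> s \<inter> s'"
      using l m s s' \<phi>0 \<psi>0 by force
    ultimately obtain y where y: "y \<in> s" "y \<in> s'" "y \<noteq> p"
      by blast
    obtain t u where t: "t \<in> {0..l}" "y = \<phi> t" and u: "u \<in> {0..m}" "y = \<psi> u"
      using y s s' by blast
    with dp dp' have tu: "u = t"
      by metis
    have eq: "\<phi> r = \<psi> r" if r: "r \<in> {0..l}" "r \<in> {0..m}" for r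
    proof -
      have "between dist_Lambda 0 r t \<or> between dist_Lambda 0 t r"
        using r(1) t(1) unfolding between_def dist_Lambda_def by auto
      then have "between d p (\<phi> r) y \<or> between d p y (\<phi> r)"
        and "between d p (\<psi> r) y \<or> between d p y (\<psi> r)"
        using D[of 0 t] D[of 0 r] D[of r t] D[of t r] D'[of 0 t] D'[of 0 r] D'[of r t] D'[of t r]
          t u tu r l m \<phi>0 \<psi>0
        unfolding between_def by auto
      moreover have "d p (\<phi> r) = d p (\<psi> r)"
        using dp dp' r by simp
      moreover have "p \<in> X" "y \<in> X" "\<phi> r \<in> X" "\<psi> r \<in> X"
        using X X' r t(1) l \<phi>0 t(2) by (metis atLeastAtMost_iff order.refl)+
      ultimately show ?thesis
        using nb y(3) unfolding nonbranching_def by metis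
    qed
    show ?thesis
    proof (cases "l \<le> m")
      case True
      then have "\<phi> r \<in> s'" if "r \<in> {0..l}" for r
      proof -
        have "r \<in> {0..m}"
          using that True by auto
        with that show ?thesis
          using eq[of r] s' by simp
      qed
      then have "s \<subseteq> s'"
        using s by blast
      then show ?thesis by simp
    next
      case False
      then have "\<psi> r \<in> s" if "r \<in> {0..m}" for r
      proof -
        have "r \<in> {0..l}"
          using that False by auto
        with that show ?thesis
          using eq[of r, symmetric] s by simp
      qed
      then have "s' \<subseteq> s"
        using s' by blast
      then show ?thesis by simp
    qed
  qed simp
qed

lemma axiom3_if_nonbranching:
  fixes d :: "'x \<Rightarrow> 'x \<Rightarrow> 'l::linordered_ab_group_add"
  assumes "nonbranching X d"
  shows "axiom3 X d"
  unfolding axiom3_def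
proof (intro allI impI, elim conjE)
  fix s s' p
  assume seg: "segment X d s" "segment X d s'" and e: "endpoint X d s p" "endpoint X d s' p"
  have "segment X d {p}"
  proof -
    obtain l \<phi> where "0 \<le> l" "isometric_embedding X d 0 l \<phi>" "\<phi> 0 = p"
      using e(1) by (metis isometric_embedding_from_endpoint)
    then have "isometric_embedding X d 0 0 \<phi>" "{p} = \<phi> ` {0..0}"
      unfolding isometric_embedding_def by auto
    then show ?thesis
      unfolding segment_def segment_with_endpoints_def by blast
  qed
  with segment_Int_cases[OF assms e] seg show "segment X d (s \<inter> s')"
    by (metis inf.absorb1 inf.absorb2)
qed

text \<open>If the segments from \<open>x\<close> to \<open>y\<close> and to \<open>z\<close> meet
  only in \<open>x\<close>, axiom (2) puts the three points in one segment; if they are nested, the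
  larger one contains them already.\<close>

lemma not_axiom2_if_nonbranching:
  fixes d :: "'x \<Rightarrow> 'x \<Rightarrow> 'l::linordered_ab_group_add"
  assumes nb: "nonbranching X d" and ax: "axiom1 X d" and mem: "x \<in> X" "y \<in> X" "z \<in> X"
    and not_between: "\<not> between d x y z" "\<not> between d x z y" "\<not> between d y x z"
  shows "\<not> axiom2 X d"
proof
  assume ax2: "axiom2 X d"
  obtain s s' where s: "segment_with_endpoints X d s {x, y}"
    and s': "segment_with_endpoints X d s' {x, z}"
    using ax mem unfolding axiom1_def by metis
  have ends: "endpoint X d s x" "endpoint X d s' x" and seg: "segment X d s" "segment X d s'"
    using s s' unfolding endpoint_def segment_def by blast+
  have sub: "E \<subseteq> s" if "segment_with_endpoints X d s E" for s E
    using that unfolding segment_with_endpoints_def by auto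
  have in_s: "x \<in> s" "y \<in> s" "x \<in> s'" "z \<in> s'"
    using sub[OF s] sub[OF s'] by auto
  consider "s \<inter> s' = {x}" | "s \<subseteq> s'" | "s' \<subseteq> s"
    using segment_Int_cases[OF nb ends] by blast
  then obtain s'' where "segment X d s''" "x \<in> s''" "y \<in> s''" "z \<in> s''"
  proof cases
    case 1
    then have "segment X d (s \<union> s')"
      using ax2 seg ends unfolding axiom2_def by blast
    with that in_s show ?thesis by blast
  qed (use that in_s seg in blast)+
  then show False
    using segment_three_points not_between by metis
qed

section \<open>A strictly convex plane over an ordered field\<close>

text \<open>
  The function \<open>a b / (a + b)\<close> is superadditive on pairs of nonnegative elements, with equality
  only for proportional pairs: this makes the norm strictly convex, by field operations alone. At
  the origin the convention \<open>0 / 0 = 0\<close> gives the right value.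
\<close>

definition plane_norm :: "'k::linordered_field \<Rightarrow> 'k \<Rightarrow> 'k" where
  "plane_norm x y = \<bar>x\<bar> + \<bar>y\<bar> - \<bar>x\<bar> * \<bar>y\<bar> / (\<bar>x\<bar> + \<bar>y\<bar>)"

lemma plane_norm_abs [simp]: "plane_norm (\<bar>x\<bar>) (\<bar>y\<bar>) = plane_norm x y"
  by (simp add: plane_norm_def)

lemma plane_norm_minus: "plane_norm (- x) (- y) = plane_norm x y"
  by (simp add: plane_norm_def)

lemma plane_norm_commute: "plane_norm x y = plane_norm y x"
  by (simp add: plane_norm_def add.commute mult.commute)

lemma plane_norm_zero [simp]: "plane_norm 0 0 = 0"
  by (simp add: plane_norm_def)

lemma plane_norm_scale: "plane_norm (c * x) (c * y) = \<bar>c\<bar> * plane_norm x y"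
proof (cases "c = 0 \<or> x = 0 \<and> y = 0")
  case False
  then have "\<bar>c\<bar> \<noteq> 0" "\<bar>x\<bar> + \<bar>y\<bar> \<noteq> 0" "\<bar>c\<bar> * \<bar>x\<bar> + \<bar>c\<bar> * \<bar>y\<bar> \<noteq> 0"
    by (auto simp: add_nonneg_eq_0_iff simp flip: distrib_left)
  then show ?thesis
    by (simp add: plane_norm_def abs_mult right_diff_distrib flip: distrib_left)
qed auto

text \<open>After clearing denominators the increment is \<open>a' - a\<close> times
  \<open>a * a' + a * b + b * a'\<close> over a positive number, and \<open>b * a'\<close> is
  positive when \<open>b > 0\<close>. For \<open>b = 0\<close> the norm is the other
  coordinate.\<close>

lemma plane_norm_strict_mono:
  assumes "0 \<le> a" "a < a'" "0 \<le> b"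
  shows "plane_norm a b < plane_norm a' b"
proof (cases "b = 0")
  case False
  with assms have pos: "0 < a + b" "0 < a' + b" by auto
  have "plane_norm a' b - plane_norm a b = (a' - a) * ((a + b) * (a' + b) - b * b) / ((a + b) * (a' + b))"
    using assms pos by (simp add: plane_norm_def divide_simps) (simp add: algebra_simps)
  moreover have "(a + b) * (a' + b) - b * b = a * a' + a * b + b * a'"
    by (simp add: algebra_simps)
  moreover have "0 < a * a' + a * b + b * a'"
    using assms False by (intro add_nonneg_pos add_nonneg_nonneg mult_pos_pos mult_nonneg_nonneg) auto
  ultimately have "0 < plane_norm a' b - plane_norm a b"
    using assms pos by (metis diff_gt_0_iff_gt divide_pos_pos mult_pos_pos)
  then show ?thesis by simp
qed (use assms in \<open>simp add: plane_norm_def\<close>)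

lemma plane_norm_mono:
  assumes "0 \<le> a" "a \<le> a'" "0 \<le> b" "b \<le> b'"
  shows "plane_norm a b \<le> plane_norm a' b'"
    and "plane_norm a b = plane_norm a' b' \<Longrightarrow> a = a' \<and> b = b'"
proof -
  have 1: "plane_norm a b \<le> plane_norm a' b" "plane_norm a b = plane_norm a' b \<Longrightarrow> a = a'"
    using plane_norm_strict_mono[of a a' b] assms by (cases "a = a'"; force)+
  have 2: "plane_norm a' b \<le> plane_norm a' b'" "plane_norm a' b = plane_norm a' b' \<Longrightarrow> b = b'"
    using plane_norm_strict_mono[of b b' a'] assms
    by (cases "b = b'"; force simp: plane_norm_commute[of a'])+
  show "plane_norm a b \<le> plane_norm a' b'"
    using 1 2 by order
  show "a = a' \<and> b = b'" if "plane_norm a b = plane_norm a' b'"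
    using 1 2 that by (metis order.antisym)
qed

lemma plane_norm_pos: "0 < plane_norm x y" if "x \<noteq> 0 \<or> y \<noteq> 0"
  using plane_norm_mono[of 0 "\<bar>x\<bar>" 0 "\<bar>y\<bar>"] that by (force simp: order_less_le)

lemma plane_norm_nonneg: "0 \<le> plane_norm x y"
  using plane_norm_mono[of 0 "\<bar>x\<bar>" 0 "\<bar>y\<bar>"] by simp

lemma plane_norm_eq_0_iff: "plane_norm x y = 0 \<longleftrightarrow> x = 0 \<and> y = 0"
  using plane_norm_pos[of x y] by (cases "x = 0 \<and> y = 0") auto

text \<open>The defect in the triangle inequality is the square of the determinant
  \<open>a * b' - a' * b\<close> over a positive denominator. This is the source of strict
  convexity.\<close>

lemma plane_norm_add_quadrant:
  assumes "0 \<le> a" "0 \<le> b" "0 \<le> a'" "0 \<le> b'"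
  shows "plane_norm (a + a') (b + b') \<le> plane_norm a b + plane_norm a' b'"
    and "plane_norm (a + a') (b + b') = plane_norm a b + plane_norm a' b' \<Longrightarrow> a * b' = a' * b"
proof -
  consider "a = 0 \<and> b = 0" | "a' = 0 \<and> b' = 0" | "0 < a + b" "0 < a' + b'"
    using assms by (metis add_nonneg_eq_0_iff add_nonneg_nonneg order_less_le)
  then have "plane_norm (a + a') (b + b') \<le> plane_norm a b + plane_norm a' b' \<and>
    (plane_norm (a + a') (b + b') = plane_norm a b + plane_norm a' b' \<longrightarrow> a * b' = a' * b)"
  proof cases
    case 3
    define s s' where "s = a + b" and "s' = a' + b'"
    \<comment> \<open>Substituting for \<open>a\<close> and \<open>a'\<close> turns the denominators
      into single variables and their sum, which leaves a polynomial identity.\<close>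
    have s: "0 < s" "0 < s'" "a = s - b" "a' = s' - b'"
      using 3 by (auto simp: s_def s'_def)
    have "plane_norm a b + plane_norm a' b' - plane_norm (a + a') (b + b')
      = (a + a') * (b + b') / (s + s') - a * b / s - a' * b' / s'"
      using assms by (simp add: plane_norm_def s_def s'_def algebra_simps)
    also have "\<dots> = (a * b' - a' * b)\<^sup>2 / (s * s' * (s + s'))"
      using s(1,2) add_pos_pos[OF s(1,2)] unfolding s(3,4)
      by (simp add: divide_simps) (simp add: algebra_simps power2_eq_square)
    finally have *: "plane_norm a b + plane_norm a' b' - plane_norm (a + a') (b + b')
      = (a * b' - a' * b)\<^sup>2 / (s * s' * (s + s'))" .
    have "0 \<le> (a * b' - a' * b)\<^sup>2 / (s * s' * (s + s'))"
      using s(1,2) by simp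
    with * have "plane_norm (a + a') (b + b') \<le> plane_norm a b + plane_norm a' b'"
      by (metis diff_ge_0_iff_ge)
    moreover have "a * b' = a' * b" if "plane_norm (a + a') (b + b') = plane_norm a b + plane_norm a' b'"
      using * that s(1,2) by auto
    ultimately show ?thesis by blast
  qed auto
  then show "plane_norm (a + a') (b + b') \<le> plane_norm a b + plane_norm a' b'"
    and "plane_norm (a + a') (b + b') = plane_norm a b + plane_norm a' b' \<Longrightarrow> a * b' = a' * b"
    by blast+
qed

lemma plane_norm_triangle: "plane_norm (x + x') (y + y') \<le> plane_norm x y + plane_norm x' y'"
proof -
  have "plane_norm (\<bar>x + x'\<bar>) (\<bar>y + y'\<bar>) \<le> plane_norm (\<bar>x\<bar> + \<bar>x'\<bar>) (\<bar>y\<bar> + \<bar>y'\<bar>)"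
    by (intro plane_norm_mono) (auto simp: abs_triangle_ineq)
  also have "\<dots> \<le> plane_norm (\<bar>x\<bar>) (\<bar>y\<bar>) + plane_norm (\<bar>x'\<bar>) (\<bar>y'\<bar>)"
    by (intro plane_norm_add_quadrant) auto
  finally show ?thesis by simp
qed

text \<open>Equality forces equality in both steps of the triangle inequality. Monotonicity then
  excludes cancellation in either coordinate, and the quadrant case makes the absolute values
  proportional, so the vectors point the same way. The cross-multiplied form also covers zero
  vectors.\<close>

lemma plane_norm_triangle_eq:
  assumes eq: "plane_norm (x + x') (y + y') = plane_norm x y + plane_norm x' y'"
  shows "plane_norm x y * x' = plane_norm x' y' * x" "plane_norm x y * y' = plane_norm x' y' * y"
proof -
  have le1: "plane_norm (\<bar>x + x'\<bar>) (\<bar>y + y'\<bar>) \<le> plane_norm (\<bar>x\<bar> + \<bar>x'\<bar>) (\<bar>y\<bar> + \<bar>y'\<bar>)"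
    by (intro plane_norm_mono) (auto simp: abs_triangle_ineq)
  have le2: "plane_norm (\<bar>x\<bar> + \<bar>x'\<bar>) (\<bar>y\<bar> + \<bar>y'\<bar>) \<le> plane_norm (\<bar>x\<bar>) (\<bar>y\<bar>) + plane_norm (\<bar>x'\<bar>) (\<bar>y'\<bar>)"
    by (intro plane_norm_add_quadrant) auto
  have "plane_norm (\<bar>x + x'\<bar>) (\<bar>y + y'\<bar>) = plane_norm (\<bar>x\<bar> + \<bar>x'\<bar>) (\<bar>y\<bar> + \<bar>y'\<bar>)"
    using le1 le2 eq by simp
  then have signs: "\<bar>x + x'\<bar> = \<bar>x\<bar> + \<bar>x'\<bar>" "\<bar>y + y'\<bar> = \<bar>y\<bar> + \<bar>y'\<bar>"
    using plane_norm_mono(2)[of "\<bar>x + x'\<bar>" "\<bar>x\<bar> + \<bar>x'\<bar>" "\<bar>y + y'\<bar>" "\<bar>y\<bar> + \<bar>y'\<bar>"]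
    by (auto simp: abs_triangle_ineq)
  have "plane_norm (\<bar>x\<bar> + \<bar>x'\<bar>) (\<bar>y\<bar> + \<bar>y'\<bar>) = plane_norm (\<bar>x\<bar>) (\<bar>y\<bar>) + plane_norm (\<bar>x'\<bar>) (\<bar>y'\<bar>)"
    using le1 le2 eq by simp
  then have cross: "\<bar>x\<bar> * \<bar>y'\<bar> = \<bar>x'\<bar> * \<bar>y\<bar>"
    by (intro plane_norm_add_quadrant) auto
  have sgn: "n * u' = n' * u" if "\<bar>u + u'\<bar> = \<bar>u\<bar> + \<bar>u'\<bar>" "n * \<bar>u'\<bar> = n' * \<bar>u\<bar>" for n n' u u' :: 'a
    using that by (auto simp: abs_if split: if_splits)
  have "plane_norm x y * \<bar>x'\<bar> = plane_norm (\<bar>x'\<bar> * \<bar>x\<bar>) (\<bar>x'\<bar> * \<bar>y\<bar>)"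
    by (simp add: plane_norm_scale)
  also have "\<dots> = plane_norm (\<bar>x\<bar> * \<bar>x'\<bar>) (\<bar>x\<bar> * \<bar>y'\<bar>)"
    by (simp only: cross mult.commute)
  also have "\<dots> = plane_norm x' y' * \<bar>x\<bar>"
    by (simp add: plane_norm_scale)
  finally show "plane_norm x y * x' = plane_norm x' y' * x"
    by (rule sgn[OF signs(1)])
  have "plane_norm x y * \<bar>y'\<bar> = plane_norm (\<bar>y'\<bar> * \<bar>x\<bar>) (\<bar>y'\<bar> * \<bar>y\<bar>)"
    by (simp add: plane_norm_scale)
  also have "\<dots> = plane_norm (\<bar>y\<bar> * \<bar>x'\<bar>) (\<bar>y\<bar> * \<bar>y'\<bar>)"
    using cross by (metis mult.commute)
  also have "\<dots> = plane_norm x' y' * \<bar>y\<bar>"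
    by (simp add: plane_norm_scale)
  finally show "plane_norm x y * y' = plane_norm x' y' * y"
    by (rule sgn[OF signs(2)])
qed

section \<open>The plane as a metric space\<close>

definition plane_dist :: "'k::linordered_field \<times> 'k \<Rightarrow> 'k \<times> 'k \<Rightarrow> 'k" where
  "plane_dist p q = plane_norm (fst q - fst p) (snd q - snd p)"

lemma Lambda_metric_space_plane: "Lambda_metric_space UNIV plane_dist"
  unfolding Lambda_metric_space_def plane_dist_def
proof (intro conjI ballI)
  fix p q r :: "'a \<times> 'a"
  show "0 \<le> plane_norm (fst q - fst p) (snd q - snd p)"
    by (rule plane_norm_nonneg)
  show "plane_norm (fst q - fst p) (snd q - snd p) = 0 \<longleftrightarrow> p = q"
    by (auto simp: plane_norm_eq_0_iff prod_eq_iff)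
  show "plane_norm (fst q - fst p) (snd q - snd p) = plane_norm (fst p - fst q) (snd p - snd q)"
    using plane_norm_minus[of "fst q - fst p" "snd q - snd p"] by simp
  show "plane_norm (fst r - fst p) (snd r - snd p) \<le>
      plane_norm (fst q - fst p) (snd q - snd p) + plane_norm (fst r - fst q) (snd r - snd q)"
    using plane_norm_triangle[of "fst q - fst p" "fst r - fst q" "snd q - snd p" "snd r - snd q"]
    by simp
qed

lemma axiom1_plane: "axiom1 UNIV (plane_dist :: 'k::linordered_field \<times> 'k \<Rightarrow> _)"
  unfolding axiom1_def
proof (intro ballI)
  fix p q :: "'k \<times> 'k"
  define n where "n = plane_dist p q"
  \<comment> \<open>The straight line at unit speed. For \<open>p = q\<close> the default
    \<open>t / 0 = 0\<close> makes it constant.\<close>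
  define \<phi> where "\<phi> t = (fst p + t / n * (fst q - fst p), snd p + t / n * (snd q - snd p))" for t
  have n: "0 \<le> n" "n = 0 \<longleftrightarrow> p = q"
    unfolding n_def plane_dist_def by (auto simp: plane_norm_nonneg plane_norm_eq_0_iff prod_eq_iff)
  have "plane_dist (\<phi> t) (\<phi> t') = dist_Lambda t t'" if "t \<in> {0..n}" "t' \<in> {0..n}" for t t'
  proof (cases "n = 0")
    case False
    have "plane_dist (\<phi> t) (\<phi> t') = plane_norm ((t' - t) / n * (fst q - fst p)) ((t' - t) / n * (snd q - snd p))"
      by (simp add: plane_dist_def \<phi>_def diff_divide_distrib left_diff_distrib)
    also have "\<dots> = \<bar>t' - t\<bar>"
      using False n(1) by (simp only: plane_norm_scale plane_dist_def[symmetric] n_def[symmetric]) simp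
    finally show ?thesis
      by (auto simp: dist_Lambda_def)
  qed (use that in \<open>simp add: plane_dist_def dist_Lambda_def\<close>)
  then have "isometric_embedding UNIV plane_dist 0 n \<phi>"
    unfolding isometric_embedding_def by blast
  moreover have "\<phi> 0 = p" "\<phi> n = q"
    using n(2) by (auto simp: \<phi>_def prod_eq_iff)
  ultimately show "\<exists>s. segment_with_endpoints UNIV plane_dist s {p, q}"
    unfolding segment_with_endpoints_def using n(1) by metis
qed

lemma nonbranching_plane: "nonbranching UNIV (plane_dist :: 'k::linordered_field \<times> 'k \<Rightarrow> _)"
proof -
  \<comment> \<open>The equations keep their meaning when \<open>y\<close> and \<open>z\<close> are
    exchanged, so they cover both orders in the definition of nonbranching: \<open>z\<close> is
    determined by \<open>y\<close> and its distance from \<open>p\<close>.\<close>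
  have par: "plane_dist p y * (fst z - fst p) = plane_dist p z * (fst y - fst p)"
    "plane_dist p y * (snd z - snd p) = plane_dist p z * (snd y - snd p)"
    if "between plane_dist p y z" for p y z :: "'k \<times> 'k"
  proof -
    have eq: "plane_dist p z = plane_dist p y + plane_dist y z"
      using that by (simp add: between_def)
    then have "plane_dist p y * (fst z - fst y) = plane_dist y z * (fst y - fst p)"
      "plane_dist p y * (snd z - snd y) = plane_dist y z * (snd y - snd p)"
      unfolding plane_dist_def
      using plane_norm_triangle_eq[of "fst y - fst p" "fst z - fst y" "snd y - snd p" "snd z - snd y"]
      by simp_all
    then show "plane_dist p y * (fst z - fst p) = plane_dist p z * (fst y - fst p)"
      "plane_dist p y * (snd z - snd p) = plane_dist p z * (snd y - snd p)"
      unfolding eq by (simp_all add: algebra_simps)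
  qed
  show ?thesis
    unfolding nonbranching_def
  proof (intro ballI impI)
    fix p y z z' :: "'k \<times> 'k"
    assume "y \<noteq> p" and eq: "plane_dist p z = plane_dist p z'"
      and "between plane_dist p z y \<or> between plane_dist p y z"
      and "between plane_dist p z' y \<or> between plane_dist p y z'"
    then have "plane_dist p y * (fst z - fst p) = plane_dist p y * (fst z' - fst p)"
      "plane_dist p y * (snd z - snd p) = plane_dist p y * (snd z' - snd p)"
      using par by metis+
    moreover have "plane_dist p y \<noteq> 0"
      using \<open>y \<noteq> p\<close> by (auto simp: plane_dist_def plane_norm_eq_0_iff prod_eq_iff)
    ultimately show "z = z'"
      by (simp add: prod_eq_iff)
  qed
qed

text \<open>The distances are 1, 1 and 3/2, and none of them is the sum of the two others.\<close>

lemma not_axiom2_plane: "\<not> axiom2 UNIV (plane_dist :: 'k::linordered_field \<times> 'k \<Rightarrow> _)"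
  by (rule not_axiom2_if_nonbranching[OF nonbranching_plane axiom1_plane, of "(0, 0)" "(1, 0)" "(0, 1)"])
    (auto simp: between_def plane_dist_def plane_norm_def)

section \<open>A circle without antipodal points\<close>

definition magnitude :: "'l::linordered_ab_group_add \<Rightarrow> 'l" where
  "magnitude u = (if 0 \<le> u then u else - u)"

lemma magnitude_nonneg: "0 \<le> magnitude u"
  using linear[of 0 u] by (auto simp: magnitude_def)

lemma magnitude_eq_0_iff: "magnitude u = 0 \<longleftrightarrow> u = 0"
  by (simp add: magnitude_def)

lemma magnitude_zero [simp]: "magnitude 0 = 0"
  by (simp add: magnitude_def)

lemma magnitude_minus [simp]: "magnitude (- u) = magnitude u"
  using linear[of 0 u] by (auto simp: magnitude_def)

lemma magnitude_diff_commute: "magnitude (u - v) = magnitude (v - u)"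
  using magnitude_minus[of "u - v"] by simp

lemma magnitude_ge: "u \<le> magnitude u" "- u \<le> magnitude u"
  by (auto simp: magnitude_def intro: order_trans[of _ 0])

lemma magnitude_triangle: "magnitude (u + v) \<le> magnitude u + magnitude v"
  using add_mono[OF magnitude_ge(1)[of u] magnitude_ge(1)[of v]]
    add_mono[OF magnitude_ge(2)[of u] magnitude_ge(2)[of v]]
  by (simp add: magnitude_def[of "u + v"] add.commute)

lemma magnitude_diff_le: "magnitude (u - v) \<le> magnitude u + magnitude v"
  using magnitude_triangle[of u "- v"] by simp

text \<open>For \<open>u > 0 > v\<close> the two possible values of the left side lead to
  \<open>v = - v\<close> or \<open>u = - u\<close>, impossible in an ordered group.\<close>

lemma magnitude_add_eq_imp_same_sign:
  assumes "magnitude (u + v) = magnitude u + magnitude v"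
  shows "0 \<le> u \<and> 0 \<le> v \<or> u \<le> 0 \<and> v \<le> 0"
proof -
  have *: "0 \<le> v" if "magnitude (u + v) = magnitude u + magnitude v" "0 < u" for u v :: 'a
  proof (rule ccontr)
    assume "\<not> 0 \<le> v"
    then have v: "v < 0" by simp
    have mags: "magnitude u = u" "magnitude v = - v"
      using that(2) \<open>\<not> 0 \<le> v\<close> by (simp_all add: magnitude_def less_imp_le)
    show False
    proof (cases "0 \<le> u + v")
      case True
      then have "u + v = u + - v"
        using that(1) unfolding mags by (simp only: magnitude_def if_True)
      then have "v = - v"
        by (simp only: add_left_cancel)
      with v show False by simp
    next
      case False
      then have "- v + - u = - v + u"
        using that(1) unfolding mags by (simp only: magnitude_def if_False minus_add add.commute)
      then have "- u = u"
        by (simp only: add_left_cancel)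
      with that(2) show False by simp
    qed
  qed
  consider "u = 0" | "0 < u" | "u < 0" by force
  then show ?thesis
  proof cases
    case 3
    have "magnitude (- u + - v) = magnitude (- u) + magnitude (- v)"
      using assms magnitude_minus[of "u + v"] by simp
    from *[OF this] 3 show ?thesis by (simp add: less_imp_le)
  qed (use *[OF assms] linear[of 0 v] in \<open>auto simp: less_imp_le\<close>)
qed

text \<open>A nonzero \<open>w\<close> selects one side of 0, and on one side the magnitude is
  injective. This later turns equal distances into equal displacements.\<close>

lemma magnitude_eq_same_sign:
  fixes u v w :: "'l::linordered_ab_group_add"
  assumes "magnitude u = magnitude v" "w \<noteq> 0"
    and "0 \<le> w \<and> 0 \<le> u \<or> w \<le> 0 \<and> u \<le> 0" "0 \<le> w \<and> 0 \<le> v \<or> w \<le> 0 \<and> v \<le> 0"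
  shows "u = v"
proof -
  from assms(2) consider "0 < w" | "w < 0" by (rule neqE)
  then have "0 \<le> u \<and> 0 \<le> v \<or> u \<le> 0 \<and> v \<le> 0"
    using assms(3,4) by cases auto
  with assms(1) show ?thesis
    by (auto simp: magnitude_def split: if_splits)
qed

lemma dist_Lambda_eq_magnitude: "dist_Lambda t t' = magnitude (t' - t)"
  by (simp add: dist_Lambda_def magnitude_def)

text \<open>A substitute for halving, which the group may not allow.\<close>

lemma add_self_less: "u < v" if "u + u < v + v" for u v :: "'l::linordered_ab_group_add"
  using that by (meson add_mono not_less)

section \<open>The subgroup generated by the circumference\<close>

definition multiples :: "'l::linordered_ab_group_add \<Rightarrow> 'l set" where
  "multiples L = {(\<Sum>i<m. L) - (\<Sum>i<n. L) | (m :: nat) (n :: nat). True}"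

lemma zero_in_multiples: "0 \<in> multiples L"
  unfolding multiples_def by (rule CollectI) (metis diff_self)

lemma self_in_multiples: "L \<in> multiples L"
proof -
  have "L = (\<Sum>i<Suc 0. L) - (\<Sum>i<0::nat. L)" by simp
  then show ?thesis
    unfolding multiples_def by blast
qed

lemma minus_in_multiples: "- u \<in> multiples L" if "u \<in> multiples L"
  using that unfolding multiples_def by (force simp: minus_diff_eq)

lemma add_in_multiples:
  fixes L :: "'l::linordered_ab_group_add"
  assumes "u \<in> multiples L" "v \<in> multiples L"
  shows "u + v \<in> multiples L"
proof -
  have sum_add: "(\<Sum>i<m + n. L) = (\<Sum>i<m. L) + (\<Sum>i<n. L)" for m n :: nat
    by (induction n) (simp_all add: add_ac)
  obtain m n m' n' :: nat where uv: "u = (\<Sum>i<m. L) - (\<Sum>i<n. L)" "v = (\<Sum>i<m'. L) - (\<Sum>i<n'. L)"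
    using assms unfolding multiples_def by blast
  have "u + v = (\<Sum>i<m + m'. L) - (\<Sum>i<n + n'. L)"
    unfolding uv sum_add by (simp add: algebra_simps)
  then show ?thesis
    unfolding multiples_def by blast
qed

lemma diff_in_multiples: "u - v \<in> multiples L" if "u \<in> multiples L" "v \<in> multiples L"
  using add_in_multiples[OF that(1) minus_in_multiples[OF that(2)]] by simp

text \<open>With more terms in one sum than in the other, the difference has magnitude at least
  \<open>L\<close>. Uniqueness of residues rests on this gap around 0.\<close>

lemma multiples_eq_0:
  fixes L :: "'l::linordered_ab_group_add"
  assumes "0 < L" "u \<in> multiples L" "magnitude u < L"
  shows "u = 0"
proof -
  have step: "L \<le> (\<Sum>i<m. L) - (\<Sum>i<n. L)" if "n < m" for m n :: nat
    using that
  proof (induction m)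
    case (Suc m)
    show ?case
    proof (cases "n = m")
      case False
      with Suc have "L + 0 \<le> (\<Sum>i<m. L) - (\<Sum>i<n. L) + L"
        using assms(1) by (intro add_mono) auto
      then show ?thesis
        by (simp add: algebra_simps)
    qed simp
  qed simp
  obtain m n :: nat where u: "u = (\<Sum>i<m. L) - (\<Sum>i<n. L)"
    using assms(2) unfolding multiples_def by blast
  have "\<not> n < m"
    using step[of n m] u assms(3) magnitude_ge(1)[of u] by auto
  moreover have "\<not> m < n"
    using step[of m n] u assms(3) magnitude_ge(2)[of u] by auto
  ultimately show ?thesis
    using u by auto
qed

locale circle =
  fixes L :: "'l::linordered_ab_group_add"
  assumes L_pos: "0 < L" and L_odd: "u + u \<noteq> L"
begin

text \<open>
  The circle consists of the balanced residues modulo \<open>L\<close>. As \<open>L\<close> is not a double, no two points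
  are antipodal, so the displacement between two points is well defined.
\<close>

definition small :: "'l \<Rightarrow> bool" where
  "small u \<longleftrightarrow> magnitude u + magnitude u < L"

lemma small_minus: "small (- u) \<longleftrightarrow> small u"
  by (simp add: small_def)

lemma small_mono: "small u" if "small v" "magnitude u \<le> magnitude v"
  using that add_mono[of "magnitude u" "magnitude v"] unfolding small_def by force

lemma small_add_less: "magnitude u + magnitude v < L" if "small u" "small v"
proof (rule add_self_less)
  have "(magnitude u + magnitude u) + (magnitude v + magnitude v) < L + L"
    using that unfolding small_def by (rule add_strict_mono)
  then show "magnitude u + magnitude v + (magnitude u + magnitude v) < L + L"
    by (simp only: ac_simps)
qed

text \<open>Two small elements differ by less than \<open>L\<close> in magnitude, so by no nonzero
  multiple of it.\<close>

lemma small_unique: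
  assumes "small u" "small v" "u - v \<in> multiples L"
  shows "u = v"
  using multiples_eq_0[OF L_pos assms(3)] small_add_less[OF assms(1,2)] magnitude_diff_le[of u v]
  by simp

definition residue :: "'l \<Rightarrow> 'l" where
  "residue u = (THE v. small v \<and> u - v \<in> multiples L)"

lemma residue_eqI: "residue u = v" if "small v" "u - v \<in> multiples L"
  unfolding residue_def
proof (rule the_equality)
  fix w
  assume "small w \<and> u - w \<in> multiples L"
  then have "small w" "w - v \<in> multiples L"
    using diff_in_multiples[OF that(2), of "u - w"] by simp_all
  with that(1) show "w = v"
    by (intro small_unique)
qed (use that in blast)

text \<open>Under the bound at most one shift by \<open>L\<close>, in either direction, suffices.
  Some bound is called for, as in a non-archimedean group an element may exceed all multiples of
  \<open>L\<close>.\<close>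

lemma residue_exists:
  assumes "magnitude u < L"
  obtains v where "small v" "u - v \<in> multiples L"
proof (cases "small u")
  case True
  with that[of u] show ?thesis
    by (simp add: zero_in_multiples)
next
  case False
  \<comment> \<open>As \<open>L\<close> is not a double, failing to be small is a strict inequality:
    there is no antipodal case.\<close>
  then have *: "L < magnitude u + magnitude u"
    using L_odd[of "magnitude u"] unfolding small_def by simp
  show ?thesis
  proof (cases "0 \<le> u")
    case True
    then have "u < L" "\<not> L \<le> u" "L < u + u"
      using * assms by (simp_all add: magnitude_def)
    then have "small (u - L)"
      by (simp add: small_def magnitude_def algebra_simps)
    then show ?thesis
      by (rule that) (simp add: self_in_multiples)
  next
    case False
    then have "- u < L" "L < - u - u"
      using * assms by (simp_all add: magnitude_def)
    then have "u + - u < u + L" "L + (u + u + L) < - u - u + (u + u + L)"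
      by (simp_all only: add_strict_left_mono add_strict_right_mono)
    then have "0 \<le> u + L" "u + L + (u + L) < L"
      by (simp_all add: algebra_simps less_imp_le)
    then have "small (u + L)"
      by (simp add: small_def magnitude_def)
    then show ?thesis
      by (rule that) (simp add: self_in_multiples minus_in_multiples)
  qed
qed

lemma residue:
  assumes "magnitude u < L"
  shows "small (residue u)" "u - residue u \<in> multiples L"
  using residue_exists[OF assms] residue_eqI by metis+

text \<open>The circle sits in the first coordinate; the zero second coordinate gives it the carrier
  type \<open>'l \<times> 'l\<close> of the theorem.\<close>

definition points :: "('l \<times> 'l) set" where
  "points = {p. small (fst p) \<and> snd p = 0}"

text \<open>This is the signed length of the shorter arc from \<open>p\<close> to
  \<open>q\<close>.\<close>

definition displacement :: "'l \<times> 'l \<Rightarrow> 'l \<times> 'l \<Rightarrow> 'l" where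
  "displacement p q = residue (fst q - fst p)"

definition arc_dist :: "'l \<times> 'l \<Rightarrow> 'l \<times> 'l \<Rightarrow> 'l" where
  "arc_dist p q = magnitude (displacement p q)"

lemma displacement:
  assumes "p \<in> points" "q \<in> points"
  shows "small (displacement p q)" "fst q - fst p - displacement p q \<in> multiples L"
proof -
  have "magnitude (fst q - fst p) < L"
    using assms small_add_less[of "fst q" "fst p"] magnitude_diff_le[of "fst q" "fst p"]
    by (simp add: points_def)
  from residue[OF this] show "small (displacement p q)" "fst q - fst p - displacement p q \<in> multiples L"
    by (simp_all add: displacement_def)
qed

lemma displacement_eqI: "displacement p q = u" if "small u" "fst q - fst p - u \<in> multiples L"
  unfolding displacement_def using that by (rule residue_eqI)

lemma points_eqI: "q = q'" if "q \<in> points" "q' \<in> points" "fst q - fst q' \<in> multiples L"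
  using that small_unique[of "fst q" "fst q'"] by (simp add: points_def prod_eq_iff)

lemma displacement_inj:
  assumes "p \<in> points" "q \<in> points" "q' \<in> points" "displacement p q = displacement p q'"
  shows "q = q'"
  using diff_in_multiples[OF displacement(2)[OF assms(1,2)] displacement(2)[OF assms(1,3)]] assms(2-4)
  by (intro points_eqI) simp_all

lemma displacement_self: "displacement p p = 0"
  by (rule displacement_eqI) (simp_all add: small_def magnitude_def L_pos zero_in_multiples)

lemma displacement_swap: "displacement q p = - displacement p q" if "p \<in> points" "q \<in> points"
  using displacement[OF that] minus_in_multiples[OF displacement(2)[OF that]]
  by (intro displacement_eqI) (simp_all add: small_minus algebra_simps)

text \<open>The sum is always congruent to the displacement from \<open>p\<close> to
  \<open>r\<close>; the hypothesis makes it small, hence equal. The inequality is directed so as to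
  serve both betweenness and a supposed failure of the triangle inequality.\<close>

lemma displacement_add:
  assumes "p \<in> points" "q \<in> points" "r \<in> points" "arc_dist p q + arc_dist q r \<le> arc_dist p r"
  shows "displacement p r = displacement p q + displacement q r"
proof (rule displacement_eqI)
  show "small (displacement p q + displacement q r)"
    using assms(4) magnitude_triangle[of "displacement p q" "displacement q r"]
    by (intro small_mono[OF displacement(1)[OF assms(1,3)]]) (simp add: arc_dist_def)
  show "fst r - fst p - (displacement p q + displacement q r) \<in> multiples L"
    using add_in_multiples[OF displacement(2)[OF assms(1,2)] displacement(2)[OF assms(2,3)]]
    by (simp add: algebra_simps)
qed

section \<open>The circle as a geodesic nonbranching space\<close>

lemma Lambda_metric_space_circle: "Lambda_metric_space points arc_dist"
  unfolding Lambda_metric_space_def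
proof (intro conjI ballI)
  fix p q
  assume pq: "p \<in> points" "q \<in> points"
  show "0 \<le> arc_dist p q"
    by (simp add: arc_dist_def magnitude_nonneg)
  show "arc_dist p q = 0 \<longleftrightarrow> p = q"
    using displacement_inj[of p q p] displacement_self[of p] pq
    by (auto simp: arc_dist_def magnitude_eq_0_iff)
  show "arc_dist p q = arc_dist q p"
    using displacement_swap[OF pq] by (simp add: arc_dist_def)
  fix r
  assume "r \<in> points"
  then show "arc_dist p r \<le> arc_dist p q + arc_dist q r"
    using displacement_add[of p q r] pq magnitude_triangle[of "displacement p q" "displacement q r"]
    by (cases "arc_dist p r \<le> arc_dist p q + arc_dist q r") (auto simp: arc_dist_def)
qed

lemma axiom1_circle: "axiom1 points arc_dist"
  unfolding axiom1_def
proof (intro ballI)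
  fix p q
  assume pq: "p \<in> points" "q \<in> points"
  define c where "c = displacement p q"
  define v where "v t = (if 0 \<le> c then t else - t)" for t :: 'l
  define \<phi> where "\<phi> t = (residue (fst p + v t), 0 :: 'l)" for t
  have c: "small c" "fst q - fst p - c \<in> multiples L"
    unfolding c_def by (intro displacement pq)+
  have v: "magnitude (v t' - v t) = magnitude (t' - t)" for t t'
    using magnitude_diff_commute[of t t'] by (simp add: v_def)
  \<comment> \<open>Signed travel \<open>v\<close> in the direction of \<open>c\<close> varies by at
    most the length of the arc, so its differences are small and will be the displacements between
    the points \<open>\<phi> t\<close>.\<close>
  have small_v: "small (v t' - v t)" if "t \<in> {0..magnitude c}" "t' \<in> {0..magnitude c}" for t t'
  proof (rule small_mono[OF c(1)])
    have "t' - t \<le> magnitude c - 0" "t - t' \<le> magnitude c - 0"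
      using that by (intro diff_mono; simp)+
    then show "magnitude (v t' - v t) \<le> magnitude c"
      unfolding v by (simp add: magnitude_def[of "t' - t"])
  qed
  \<comment> \<open>The sum may leave the balanced range, but its magnitude is below
    \<open>L\<close>, so its residue exists.\<close>
  have res: "small (residue (fst p + v t))" "fst p + v t - residue (fst p + v t) \<in> multiples L"
    if "t \<in> {0..magnitude c}" for t
  proof -
    have "small (v t)" "small (fst p)"
      using small_v[of 0 t] that pq(1) by (auto simp: v_def points_def magnitude_nonneg)
    then have "magnitude (fst p + v t) < L"
      using small_add_less magnitude_triangle by (metis order.strict_trans1)
    from residue[OF this] show "small (residue (fst p + v t))"
      "fst p + v t - residue (fst p + v t) \<in> multiples L" .
  qed
  have "\<phi> ` {0..magnitude c} \<subseteq> points"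
    using res(1) by (auto simp: points_def \<phi>_def)
  moreover have "arc_dist (\<phi> t) (\<phi> t') = dist_Lambda t t'"
    if t: "t \<in> {0..magnitude c}" "t' \<in> {0..magnitude c}" for t t'
  proof -
    have "displacement (\<phi> t) (\<phi> t') = v t' - v t"
      using small_v[OF t] diff_in_multiples[OF res(2)[OF t(1)] res(2)[OF t(2)]]
      by (intro displacement_eqI) (simp_all add: \<phi>_def algebra_simps)
    then show ?thesis
      by (simp add: arc_dist_def v dist_Lambda_eq_magnitude)
  qed
  ultimately have "isometric_embedding points arc_dist 0 (magnitude c) \<phi>"
    unfolding isometric_embedding_def by blast
  moreover have "\<phi> 0 = p"
  proof -
    have "residue (fst p + v 0) = fst p"
      using pq(1) by (intro residue_eqI) (simp_all add: v_def points_def zero_in_multiples)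
    then show ?thesis
      using pq(1) by (simp add: \<phi>_def points_def prod_eq_iff)
  qed
  moreover have "\<phi> (magnitude c) = q"
  proof -
    have "v (magnitude c) = c"
      by (simp add: v_def magnitude_def)
    moreover have "residue (fst p + c) = fst q"
      using pq(2) minus_in_multiples[OF c(2)]
      by (intro residue_eqI) (simp_all add: points_def algebra_simps)
    ultimately show ?thesis
      using pq(2) by (simp add: \<phi>_def points_def prod_eq_iff)
  qed
  ultimately show "\<exists>s. segment_with_endpoints points arc_dist s {p, q}"
    unfolding segment_with_endpoints_def using magnitude_nonneg by metis
qed

text \<open>Betweenness makes displacements add without cancellation, so \<open>y\<close> and
  \<open>z\<close> are reached from \<open>p\<close> in the same direction. Direction and distance
  determine the point.\<close>

lemma nonbranching_circle: "nonbranching points arc_dist"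
proof -
  have same_sign: "0 \<le> displacement p y \<and> 0 \<le> displacement p z \<or> displacement p y \<le> 0 \<and> displacement p z \<le> 0"
    if mem: "p \<in> points" "y \<in> points" "z \<in> points"
      and "between arc_dist p y z" for p y z
  proof -
    have eq: "arc_dist p z = arc_dist p y + arc_dist y z"
      using that by (simp add: between_def)
    then have "displacement p z = displacement p y + displacement y z"
      by (intro displacement_add mem) simp
    then show ?thesis
      using magnitude_add_eq_imp_same_sign[of "displacement p y" "displacement y z"] eq
      by (auto simp: arc_dist_def add_nonpos_nonpos)
  qed
  show ?thesis
    unfolding nonbranching_def
  proof (intro ballI impI)
    fix p y z z'
    assume mem: "p \<in> points" "y \<in> points" "z \<in> points" "z' \<in> points"
      and "y \<noteq> p" and eq: "arc_dist p z = arc_dist p z'"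
      and z: "between arc_dist p z y \<or> between arc_dist p y z"
      and z': "between arc_dist p z' y \<or> between arc_dist p y z'"
    have "magnitude (displacement p z) = magnitude (displacement p z')"
      using eq by (simp only: arc_dist_def)
    moreover have "displacement p y \<noteq> 0"
      using displacement_inj[of p y p] displacement_self[of p] mem \<open>y \<noteq> p\<close> by auto
    moreover have "0 \<le> displacement p y \<and> 0 \<le> displacement p z \<or> displacement p y \<le> 0 \<and> displacement p z \<le> 0"
      using same_sign[of p y z] same_sign[of p z y] mem z by blast
    moreover have "0 \<le> displacement p y \<and> 0 \<le> displacement p z' \<or> displacement p y \<le> 0 \<and> displacement p z' \<le> 0"
      using same_sign[of p y z'] same_sign[of p z' y] mem z' by blast
    ultimately have "displacement p z = displacement p z'"
      by (rule magnitude_eq_same_sign)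
    then show "z = z'"
      by (rule displacement_inj[OF mem(1,3,4)])
  qed
qed

text \<open>The points \<open>0\<close>, \<open>l\<close> and \<open>- l\<close> are pairwise at
  distance \<open>l > 0\<close>, and betweenness would read \<open>l = l + l\<close>.\<close>

lemma not_axiom2_circle:
  assumes L: "L = l + l + l"
  shows "\<not> axiom2 points arc_dist"
proof -
  have "0 < l"
  proof (rule ccontr)
    assume "\<not> 0 < l"
    then have "l + l + l \<le> 0"
      by (intro add_nonpos_nonpos) auto
    with L_pos L show False by simp
  qed
  then have "magnitude l = l" "l + l < L"
    unfolding L by (simp_all add: magnitude_def less_imp_le)
  then have small: "small 0" "small l" "small (- l)"
    using L_pos by (simp_all add: small_def)
  have "displacement (0, 0) (l, 0) = l" "displacement (l, 0) (0, 0) = - l"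
    "displacement (0, 0) (- l, 0) = - l" "displacement (- l, 0) (0, 0) = l"
    using small by (auto intro!: displacement_eqI simp: zero_in_multiples)
  moreover have "displacement (l, 0) (- l, 0) = l" "displacement (- l, 0) (l, 0) = - l"
  proof -
    \<comment> \<open>The raw differences \<open>- l - l\<close> and \<open>l + l\<close> are too
      long to be small; modulo \<open>L = l + l + l\<close> they become \<open>l\<close> and
      \<open>- l\<close>.\<close>
    have "- l - l - l = - L" "l - - l - - l = L"
      by (simp_all add: L)
    then show "displacement (l, 0) (- l, 0) = l" "displacement (- l, 0) (l, 0) = - l"
      using small self_in_multiples[of L] minus_in_multiples[OF self_in_multiples, of L]
      by (simp_all only: displacement_eqI fst_conv)
  qed
  ultimately have "arc_dist p q = l"
    if "p \<noteq> q" "p \<in> {(0, 0), (l, 0), (- l, 0)}" "q \<in> {(0, 0), (l, 0), (- l, 0)}" for p q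
    using that \<open>0 < l\<close> by (auto simp: arc_dist_def magnitude_def)
  moreover have "l \<noteq> - l" "l \<noteq> 0"
    using \<open>0 < l\<close> by auto
  ultimately have "\<not> between arc_dist (0, 0) (l, 0) (- l, 0)"
    "\<not> between arc_dist (0, 0) (- l, 0) (l, 0)" "\<not> between arc_dist (l, 0) (0, 0) (- l, 0)"
    by (simp_all add: between_def)
  moreover have "(0, 0) \<in> points" "(l, 0) \<in> points" "(- l, 0) \<in> points"
    using small by (simp_all add: points_def)
  ultimately show ?thesis
    by (intro not_axiom2_if_nonbranching[OF nonbranching_circle axiom1_circle])
qed

end

text \<open>
  On a circle of circumference \<open>m + m + m\<close> the points \<open>0\<close>, \<open>m\<close>, \<open>- m\<close> are equidistant.
\<close>

lemma circle_triple:
  fixes l :: "'l::linordered_ab_group_add"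
  assumes "l \<notin> double_Lambda"
  obtains m :: 'l where "circle (m + m + m)"
proof -
  \<comment> \<open>Three times a non-double is a non-double: \<open>u + u = m + m + m\<close> would
    exhibit \<open>m\<close>, and with it \<open>l\<close>, as a double. Both signs are treated
    because the circumference must be positive.\<close>
  have odd: "u + u \<noteq> m + m + m" if "m = l \<or> m = - l" for u m
  proof
    assume "u + u = m + m + m"
    then have *: "m = (u - m) + (u - m)"
      by (simp add: algebra_simps)
    from that have "l = (u - m) + (u - m) \<or> l = (m - u) + (m - u)"
    proof
      assume "m = - l"
      then have "l = - ((u - m) + (u - m))"
        using * by (metis minus_minus)
      then show ?thesis by simp
    qed (use * in simp)
    with assms show False
      unfolding double_Lambda_def by blast
  qed
  have "l \<noteq> 0"
    using assms unfolding double_Lambda_def by force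
  then consider "0 < l" | "0 < - l" by force
  then show thesis
  proof cases
    case 1
    with odd show thesis by (intro that[of l]) (auto simp: circle_def add_pos_pos)
  next
    case 2
    with odd show thesis by (intro that[of "- l"]) (unfold_locales; simp only: add_pos_pos not_False_eq_True simp_thms)
  qed
qed

section \<open>Independence of axiom (2)\<close>

theorem theorem2:
  "((double_Lambda :: 'l::linordered_ab_group_add set) \<noteq> UNIV \<longrightarrow>
      (\<exists>(X :: ('l \<times> 'l) set) (d :: 'l \<times> 'l \<Rightarrow> 'l \<times> 'l \<Rightarrow> 'l).
         Lambda_metric_space X d \<and> axiom1 X d \<and> axiom3 X d \<and> \<not> axiom2 X d)) \<and>
   (\<exists>(X :: ('k::linordered_field \<times> 'k) set) (d :: 'k \<times> 'k \<Rightarrow> 'k \<times> 'k \<Rightarrow> 'k).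
      Lambda_metric_space X d \<and> axiom1 X d \<and> axiom3 X d \<and> \<not> axiom2 X d)"
proof (intro conjI impI)
  assume "(double_Lambda :: 'l set) \<noteq> UNIV"
  then obtain l :: 'l where "l \<notin> double_Lambda"
    by blast
  then obtain m :: 'l where "circle (m + m + m)"
    by (rule circle_triple)
  then interpret circle "m + m + m" .
  show "\<exists>(X :: ('l \<times> 'l) set) (d :: 'l \<times> 'l \<Rightarrow> 'l \<times> 'l \<Rightarrow> 'l).
      Lambda_metric_space X d \<and> axiom1 X d \<and> axiom3 X d \<and> \<not> axiom2 X d"
    using Lambda_metric_space_circle axiom1_circle axiom3_if_nonbranching[OF nonbranching_circle]
      not_axiom2_circle[OF refl] by blast
next
  show "\<exists>(X :: ('k \<times> 'k) set) (d :: 'k \<times> 'k \<Rightarrow> 'k \<times> 'k \<Rightarrow> 'k).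
      Lambda_metric_space X d \<and> axiom1 X d \<and> axiom3 X d \<and> \<not> axiom2 X d"
    using Lambda_metric_space_plane axiom1_plane axiom3_if_nonbranching[OF nonbranching_plane]
      not_axiom2_plane by blast
qed

end
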